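(* Let $n \in \mathbb{N}$ with $n\ge 1$, and let $\alpha > -1$, $\beta > 0$ be real numbers such that the Jacobi polynomials $P_n^{(\alpha,\beta)}(x)$ and $P_{n+1}^{(\alpha,\beta+1)}(x)$ have no common zeros. Let $$l_n = -1 + \frac{2(n+1)(\alpha+n+1)}{(\alpha+\beta+2n+2)(\alpha+\beta+2n+3)}.$$ Let $-1 < w_1 < w_2 < \dots < w_n < w_{n+1} < 1$ be the zeros of $P_{n+1}^{(\alpha,\beta+1)}(x)$ in increasing order. Then each of the $n+1$ open intervals $(-1,w_1), (w_1,w_2), \dots, (w_n,w_{n+1})$ contains either exactly one simple zero of $P_n^{(\alpha,\beta)}(x)$ or the point $l_n$, but not both. Moreover, the zeros of $P_n^{(\alpha,\beta)}(x)$ and $P_{n+1}^{(\alpha,\beta+1)}(x)$ are interlacing if and only if the smallest zero $w_1$ of $P_{n+1}^{(\alpha,\beta+1)}(x)$ satisfies $w_1 > l_n$.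
   Context: For $\alpha,\beta>-1$, $\{P_n^{(\alpha,\beta)}(x)\}_{n=0}^\infty$ denotes the sequence of Jacobi polynomials: $P_n^{(\alpha,\beta)}$ has degree $n$ and the sequence is orthogonal on $(-1,1)$ with respect to the measure $(1-x)^\alpha(1+x)^\beta\,dx$ (the polynomials are unique up to normalization, which does not affect zeros). All $n$ zeros of $P_n^{(\alpha,\beta)}$ are real, simple and lie in $(-1,1)$. The zeros of a polynomial $p$ of degree $n$ and a polynomial $q$ of degree $n+1$, both with real simple zeros, are said to be interlacing if between each pair of consecutive zeros of $q$ there is (strictly) exactly one zero of $p$. *)

theory Defs
  imports "HOL-Analysis.Analysis" "HOL-Computational_Algebra.Polynomial"
begin

(* The normalization is left free: for alpha, beta > -1 these conditions determine each P n up to a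
   nonzero constant factor.  P 0 \<noteq> 0 is stated separately because the zero polynomial also has
   degree 0.  For alpha, beta > -1 all the integrands are integrable, so the convention that
   the integral of a non-integrable function is 0 plays no role. *)
definition jacobi_polynomials :: "real \<Rightarrow> real \<Rightarrow> (nat \<Rightarrow> real poly) \<Rightarrow> bool" where
  "jacobi_polynomials \<alpha> \<beta> P \<longleftrightarrow>
     P 0 \<noteq> 0 \<and> (\<forall>n. degree (P n) = n) \<and>
     (\<forall>m n. m \<noteq> n \<longrightarrow>
        (LINT x:{-1<..<1}|lborel.
           poly (P m) x * poly (P n) x * ((1 - x) powr \<alpha> * (1 + x) powr \<beta>)) = 0)"

(* For a nonzero polynomial, having as many distinct real zeros as its degree says that all its
   (complex) zeros are real and simple. *)
definition real_simple_zeros :: "real poly \<Rightarrow> bool" where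
  "real_simple_zeros p \<longleftrightarrow> p \<noteq> 0 \<and> card {x. poly p x = 0} = degree p"

definition interlacing_zeros :: "real poly \<Rightarrow> real poly \<Rightarrow> bool" where
  "interlacing_zeros p q \<longleftrightarrow>
     degree q = degree p + 1 \<and> real_simple_zeros p \<and> real_simple_zeros q \<and>
     (\<forall>a b. a < b \<and> poly q a = 0 \<and> poly q b = 0 \<and> (\<forall>x\<in>{a<..<b}. poly q x \<noteq> 0)
        \<longrightarrow> (\<exists>!x. x \<in> {a<..<b} \<and> poly p x = 0))"

end

theory Submission
  imports Defs
begin

text \<open>Write \<open>p = P n\<close> and \<open>q = Q (n + 1)\<close>.  The point \<open>l\<close> enters through the values of \<open>p\<close> at the zeros of
  \<open>q\<close>: if \<open>q = (x - v) g\<close>, then \<open>p(v)\<close> is a multiple of \<open>g(v) (v - l)\<close>, and the factor has the same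
  sign for all zeros \<open>v\<close> (lemma \<open>jacobi_value_at_zero\<close>).  This comes from evaluating the integral of
  \<open>p g\<close> against the weight with exponent \<open>\<beta> + 1\<close> in two ways.  Orthogonality of \<open>q\<close> to all polynomials
  of degree at most \<open>n\<close> gives the multiple \<open>p(v) / g(v)\<close> of the integral of \<open>g\<^sup>2\<close>.  Moving one factor
  \<open>1 + x\<close> from the weight to \<open>g\<close> and using orthogonality of the \<open>P m\<close> gives a positive constant, up to
  leading coefficients, times the coefficient of \<open>P n\<close> in the expansion of \<open>(1 + x) g\<close>.  That
  coefficient is linear in \<open>v\<close>, with a zero determined by the subleading coefficients of \<open>P (n + 1)\<close> and
  \<open>Q (n + 1)\<close>.  These are found from the symmetry of the Jacobi differential operator (lemma
  \<open>jacobi_polynomials_subleading_coeff\<close>), and the zero turns out to be \<open>l\<close>.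

  Since \<open>g(w i)\<close>, normalized by the leading coefficient, is \<open>\<Prod>j \<noteq> i. w i - w j\<close>, its signs alternate
  along the zeros of \<open>q\<close>.  Hence \<open>p\<close> changes sign between two consecutive zeros of \<open>q\<close> unless \<open>l\<close> lies
  between them.  What remains is a count of the \<open>n\<close> zeros of \<open>p\<close> (lemma
  \<open>zeros_and_extra_point_in_gaps\<close>): the sign of \<open>p\<close> at the last zero of \<open>q\<close> excludes that \<open>l\<close> lies
  beyond it, and if \<open>l\<close> is not in \<open>(-1, w 1)\<close>, then the sign at \<open>w 1\<close> forces the last missing zero of
  \<open>p\<close> to the left of \<open>w 1\<close>, while orthogonality keeps it to the right of \<open>-1\<close>.\<close>

section \<open>Integration against the Jacobi weight\<close>

definition jacobi_weight :: "real \<Rightarrow> real \<Rightarrow> real \<Rightarrow> real" where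
  "jacobi_weight a b x = (1 - x) powr a * (1 + x) powr b"

definition jacobi_functional :: "real \<Rightarrow> real \<Rightarrow> real poly \<Rightarrow> real" where
  "jacobi_functional a b f = (LINT x:{-1<..<1}|lborel. poly f x * jacobi_weight a b x)"

lemma jacobi_weight_measurable [measurable]: "jacobi_weight a b \<in> borel_measurable borel"
  unfolding jacobi_weight_def by measurable

lemma poly_measurable [measurable]: "poly (f :: real poly) \<in> borel_measurable borel"
  by (intro borel_measurable_continuous_onI continuous_intros)

lemma jacobi_weight_nonneg: "jacobi_weight a b x \<ge> 0"
  by (simp add: jacobi_weight_def)

lemma jacobi_weight_pos: "x \<in> {-1<..<1} \<Longrightarrow> jacobi_weight a b x > 0"
  by (simp add: jacobi_weight_def)

text \<open>Under \<open>t = (1 + x) / 2\<close> the weight becomes, up to a constant, the integrand of Euler's Beta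
  integral, which converges exactly for exponents above \<open>-1\<close>.\<close>

lemma set_integrable_jacobi_weight:
  assumes "a > -1" "b > -1"
  shows "set_integrable lborel {-1<..<1} (jacobi_weight a b)"
proof -
  define B where "B = (\<lambda>t::real. t powr (b + 1 - 1) * (1 - t) powr (a + 1 - 1))"
  have "(B has_integral Beta (b + 1) (a + 1)) (cbox 0 1)"
    unfolding B_def using has_integral_Beta_real[of "b+1" "a+1"] assms by auto
  from has_integral_affinity'[OF this, of "1/2" "1/2"]
  have "(\<lambda>x. B (1/2 * x + 1/2)) integrable_on {-1..1}"
    by (auto simp: has_integral_iff cbox_interval)
  moreover have "B (1/2 * x + 1/2) = 2 powr (-a-b) * jacobi_weight a b x" if "x \<in> {-1..1}" for x
  proof -
    have "1/2 * x + 1/2 = (1 + x) * (1/2)" "1 - (1/2 * x + 1/2) = (1 - x) * (1/2)"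
      by (simp_all add: field_simps)
    moreover have "2 powr (-a-b) = (1/2) powr a * (1/2) powr (b::real)"
      by (simp add: powr_add[symmetric] powr_divide powr_minus powr_diff field_simps)
    ultimately show ?thesis
      using that
      by (simp only: B_def jacobi_weight_def powr_mult add_diff_cancel_right' mult_ac)
  qed
  ultimately have "(\<lambda>x. 2 powr (-a-b) * jacobi_weight a b x) integrable_on {-1..1}"
    by (metis (no_types, lifting) integrable_cong)
  then have "jacobi_weight a b integrable_on {-1..1}"
    by (simp add: integrable_on_cmult_iff)
  then have "jacobi_weight a b integrable_on {-1<..<1}"
    by (simp add: integrable_on_open_interval_real)
  then have "jacobi_weight a b absolutely_integrable_on {-1<..<1}"
    by (rule nonnegative_absolutely_integrable_1) (rule jacobi_weight_nonneg)
  then show ?thesis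
    unfolding set_integrable_def by (subst (asm) integrable_completion) auto
qed

lemma set_integrable_poly_jacobi_weight:
  assumes "a > -1" "b > -1"
  shows "set_integrable lborel {-1<..<1} (\<lambda>x. poly f x * jacobi_weight a b x)"
proof -
  have "bounded (poly f ` {-1..1})"
    by (intro compact_imp_bounded compact_continuous_image continuous_intros) simp
  then obtain C where C: "\<forall>x\<in>{-1..1}. \<bar>poly f x\<bar> \<le> C"
    unfolding bounded_iff by auto
  show ?thesis
  proof (rule set_integrable_bound)
    show "set_integrable lborel {-1<..<1} (\<lambda>x. C * jacobi_weight a b x)"
      using set_integrable_jacobi_weight[OF assms] by (rule set_integrable_mult_right)
    show "AE x in lborel. x \<in> {-1<..<1} \<longrightarrow>
        norm (poly f x * jacobi_weight a b x) \<le> norm (C * jacobi_weight a b x)"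
    proof (intro AE_I2 impI)
      fix x :: real assume "x \<in> {-1<..<1}"
      then have "\<bar>poly f x\<bar> \<le> \<bar>C\<bar>" using C by (intro order_trans[OF _ abs_ge_self]) auto
      then show "norm (poly f x * jacobi_weight a b x) \<le> norm (C * jacobi_weight a b x)"
        by (simp add: abs_mult mult_right_mono)
    qed
  qed (simp add: set_borel_measurable_def)
qed

lemma jacobi_functional_0 [simp]: "jacobi_functional a b 0 = 0"
  by (simp add: jacobi_functional_def set_lebesgue_integral_def)

lemma jacobi_functional_add:
  assumes "a > -1" "b > -1"
  shows "jacobi_functional a b (f + g) = jacobi_functional a b f + jacobi_functional a b g"
  using set_integrable_poly_jacobi_weight[OF assms]
  by (simp add: jacobi_functional_def ring_distribs set_integral_add(2))

lemma jacobi_functional_smult: "jacobi_functional a b (smult c f) = c * jacobi_functional a b f"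
  by (simp add: jacobi_functional_def mult.assoc)

lemma jacobi_functional_diff:
  assumes "a > -1" "b > -1"
  shows "jacobi_functional a b (f - g) = jacobi_functional a b f - jacobi_functional a b g"
  using set_integrable_poly_jacobi_weight[OF assms]
  by (simp add: jacobi_functional_def ring_distribs set_integral_diff(2))

lemma jacobi_functional_pos:
  assumes "a > -1" "b > -1" "f \<noteq> 0" and nonneg: "\<And>x. x \<in> {-1<..<1} \<Longrightarrow> poly f x \<ge> 0"
  shows "jacobi_functional a b f > 0"
proof -
  define F where "F x = indicator {-1<..<1} x *\<^sub>R (poly f x * jacobi_weight a b x)" for x :: real
  have int: "integrable lborel F"
    using set_integrable_poly_jacobi_weight[OF assms(1,2)] unfolding set_integrable_def F_def .
  have F: "F x \<ge> 0" for x
    using nonneg by (simp add: F_def indicator_def jacobi_weight_nonneg)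
  have eq: "jacobi_functional a b f = integral\<^sup>L lborel F"
    by (simp add: jacobi_functional_def set_lebesgue_integral_def F_def [abs_def])
  have "integral\<^sup>L lborel F \<noteq> 0"
  proof
    assume "integral\<^sup>L lborel F = 0"
    then have "AE x in lborel. F x = 0"
      using integral_nonneg_eq_0_iff_AE[OF int] F by simp
    moreover have "AE x in lborel. x \<notin> {x. poly f x = 0}"
      by (intro AE_not_in finite_imp_null_set_lborel poly_roots_finite) fact
    ultimately have "AE x in lborel. x \<notin> {-1<..<1::real}"
    proof eventually_elim
      case (elim x)
      then show ?case using jacobi_weight_pos[of x a b] by (auto simp: F_def)
    qed
    then have "emeasure lborel {-1<..<1::real} = 0"
      by (subst (asm) AE_iff_measurable[where N = "{-1<..<1}"]) auto
    then show False by simp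
  qed
  with eq F show ?thesis by (simp add: less_le integral_nonneg_AE)
qed

text \<open>This lets every integral for the parameter \<open>b + 1\<close> be computed with the weight for \<open>b\<close>, where the
  other orthogonal family lives.\<close>

lemma jacobi_functional_Suc_weight:
  "jacobi_functional a (b + 1) f = jacobi_functional a b ([:1, 1:] * f)"
  unfolding jacobi_functional_def
  by (intro set_lebesgue_integral_cong) (auto simp: jacobi_weight_def powr_add algebra_simps)

text \<open>The integrand is the derivative of \<open>(1 - x) powr (a + 1) * (1 + x) powr (b + 1) * u x\<close>, and
  this function vanishes at both endpoints because both exponents are positive.  This identity is
  what ties the coefficients of the orthogonal polynomials to \<open>a\<close> and \<open>b\<close>.\<close>

lemma jacobi_functional_total_derivative:
  assumes "a > -1" "b > -1"
  shows "jacobi_functional a b ([:1, 0, -1:] * pderiv u + [:b - a, - (a + b + 2):] * u) = 0"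
    (is "jacobi_functional a b ?f = 0")
proof -
  define F where "F x = (1 - x) powr (a + 1) * (1 + x) powr (b + 1) * poly u x" for x
  have "((\<lambda>x. poly ?f x * jacobi_weight a b x) has_integral (F 1 - F (-1))) {-1..1}"
  proof (rule fundamental_theorem_of_calculus_interior)
    show "continuous_on {-1..1} F"
      unfolding F_def using assms by (intro continuous_intros continuous_on_powr') auto
    fix x :: real assume x: "x \<in> {-1<..<1}"
    have 1: "((\<lambda>x. (1 - x) powr (a + 1)) has_real_derivative - ((a + 1) * (1 - x) powr a)) (at x)"
      and 2: "((\<lambda>x. (1 + x) powr (b + 1)) has_real_derivative (b + 1) * (1 + x) powr b) (at x)"
      using x by (auto intro!: derivative_eq_intros DERIV_chain2[OF has_real_derivative_powr])
    have 3: "(1 - x) powr (a + 1) = (1 - x) * (1 - x) powr a"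
      and 4: "(1 + x) powr (b + 1) = (1 + x) * (1 + x) powr b"
      using x by (simp_all add: powr_add)
    have "(F has_real_derivative poly ?f x * jacobi_weight a b x) (at x)"
      unfolding F_def
      by (rule derivative_eq_intros 1 2 poly_DERIV refl)+ (simp add: 3 4 jacobi_weight_def, algebra)
    then show "(F has_vector_derivative poly ?f x * jacobi_weight a b x) (at x)"
      by (simp add: has_real_derivative_iff_has_vector_derivative)
  qed simp
  moreover have "F 1 = 0" "F (-1) = 0" using assms by (simp_all add: F_def)
  ultimately have "((\<lambda>x. poly ?f x * jacobi_weight a b x) has_integral 0) {-1<..<1}"
    by (simp add: has_integral_Icc_iff_Ioo)
  then show ?thesis
    using set_borel_integral_eq_integral(2)[OF set_integrable_poly_jacobi_weight[OF assms, of ?f]]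
    by (simp add: jacobi_functional_def integral_unique)
qed

section \<open>Consequences of orthogonality\<close>

lemma jacobi_polynomials_degree [simp]: "jacobi_polynomials a b P \<Longrightarrow> degree (P n) = n"
  by (simp add: jacobi_polynomials_def)

lemma jacobi_polynomials_nonzero: "jacobi_polynomials a b P \<Longrightarrow> P n \<noteq> 0"
  unfolding jacobi_polynomials_def by (cases n) (metis, metis degree_0 nat.distinct(1))

lemma jacobi_polynomials_coeff_nonzero: "jacobi_polynomials a b P \<Longrightarrow> coeff (P n) n \<noteq> 0"
  using jacobi_polynomials_nonzero[of a b P n] jacobi_polynomials_degree[of a b P n]
  by (metis leading_coeff_0_iff)

lemma jacobi_polynomials_orthogonal:
  "jacobi_polynomials a b P \<Longrightarrow> m \<noteq> n \<Longrightarrow> jacobi_functional a b (P m * P n) = 0"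
  by (simp add: jacobi_polynomials_def jacobi_functional_def jacobi_weight_def)

lemma jacobi_functional_square_pos:
  "a > -1 \<Longrightarrow> b > -1 \<Longrightarrow> f \<noteq> 0 \<Longrightarrow> jacobi_functional a b (f * f) > 0"
  by (intro jacobi_functional_pos) auto

text \<open>Since \<open>P k\<close> has degree exactly \<open>k\<close>, the leading term of \<open>f\<close> can be removed by a multiple of some
  \<open>P k\<close> with \<open>k < n\<close>, to which \<open>P n\<close> is orthogonal.\<close>

lemma jacobi_orthogonal_lower_degree:
  assumes P: "jacobi_polynomials a b P" and ab: "a > -1" "b > -1"
  assumes "degree f < n"
  shows "jacobi_functional a b (P n * f) = 0"
  using assms(4)
proof (induction "degree f" arbitrary: f rule: less_induct)
  case less
  define k where "k = degree f"
  define c where "c = coeff f k / coeff (P k) k"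
  define r where "r = f - smult c (P k)"
  have "degree r \<le> k" "coeff r k = 0"
    using P jacobi_polynomials_coeff_nonzero[OF P, of k]
    by (auto simp: r_def c_def k_def intro!: degree_diff_le)
  then have "r = 0 \<or> degree r < k"
    by (metis eq_zero_or_degree_less)
  then have "jacobi_functional a b (P n * r) = 0"
    using less by (auto simp: k_def)
  moreover have "P n * r = P n * f - smult c (P n * P k)"
    by (simp add: r_def algebra_simps)
  moreover have "jacobi_functional a b (P n * P k) = 0"
    using less.prems by (intro jacobi_polynomials_orthogonal[OF P]) (auto simp: k_def)
  ultimately show ?case
    by (simp add: jacobi_functional_diff[OF ab] jacobi_functional_smult)
qed

text \<open>Only the component of \<open>f\<close> along \<open>P n\<close> survives, and for \<open>degree f \<le> n\<close> that component is read
  off from the coefficient of \<open>x ^ n\<close>.  Stated without division so that it can be used in ring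
  computations.\<close>

lemma jacobi_functional_leading_coeff:
  assumes P: "jacobi_polynomials a b P" and ab: "a > -1" "b > -1"
  assumes f: "degree f \<le> n"
  shows "coeff (P n) n * jacobi_functional a b (P n * f) = coeff f n * jacobi_functional a b (P n * P n)"
proof -
  define r where "r = smult (coeff (P n) n) f - smult (coeff f n) (P n)"
  have "degree r \<le> n" "coeff r n = 0"
    using P f by (auto simp: r_def intro!: degree_diff_le)
  then have "r = 0 \<or> degree r < n"
    by (metis eq_zero_or_degree_less)
  then have "jacobi_functional a b (P n * r) = 0"
    using jacobi_orthogonal_lower_degree[OF P ab] by auto
  moreover have "P n * r = smult (coeff (P n) n) (P n * f) - smult (coeff f n) (P n * P n)"
    by (simp add: r_def algebra_simps)
  ultimately show ?thesis
    by (simp add: jacobi_functional_diff[OF ab] jacobi_functional_smult)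
qed

text \<open>If \<open>P n = (x - t) g\<close> with \<open>t \<le> -1\<close>, then \<open>P n * g = (x - t) g\<^sup>2\<close> would be nonnegative on
  \<open>(-1, 1)\<close> although \<open>P n\<close> is orthogonal to \<open>g\<close>.\<close>

lemma jacobi_polynomials_root_gt:
  assumes P: "jacobi_polynomials a b P" and ab: "a > -1" "b > -1" and t: "poly (P n) t = 0"
  shows "t > -1"
proof (rule ccontr)
  assume "\<not> t > -1"
  obtain g where g: "P n = [:- t, 1:] * g"
    using t by (metis dvdE poly_eq_0_iff_dvd)
  have "g \<noteq> 0" using g jacobi_polynomials_nonzero[OF P, of n] by auto
  then have "degree g + 1 = degree (P n)" by (simp add: g degree_mult_eq del: mult_pCons_left)
  then have "degree g < n" using P by simp
  then have "jacobi_functional a b (P n * g) = 0"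
    by (rule jacobi_orthogonal_lower_degree[OF P ab])
  moreover have "jacobi_functional a b (P n * g) > 0"
  proof (rule jacobi_functional_pos[OF ab])
    fix x :: real assume "x \<in> {-1<..<1}"
    then have "(x - t) * (poly g x * poly g x) \<ge> 0" using \<open>\<not> t > -1\<close> by simp
    then show "poly (P n * g) x \<ge> 0" by (simp add: g algebra_simps)
  qed (use g \<open>g \<noteq> 0\<close> in \<open>auto simp del: mult_pCons_left\<close>)
  ultimately show False by simp
qed

section \<open>The two leading coefficients\<close>

text \<open>The second-order operator of the Jacobi differential equation
  \<open>(1 - x\<^sup>2) y'' + (b - a - (a + b + 2) x) y' = - n (n + a + b + 1) y\<close>.\<close>

definition jacobi_operator :: "real \<Rightarrow> real \<Rightarrow> real poly \<Rightarrow> real poly" where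
  "jacobi_operator a b f =
     [:1, 0, -1:] * pderiv (pderiv f) + [:b - a, - (a + b + 2):] * pderiv f"

text \<open>The operator is triangular on powers of \<open>x\<close>, so it does not raise degrees, and its diagonal
  entries are the eigenvalues.\<close>

lemma coeff_jacobi_operator:
  "coeff (jacobi_operator a b f) j =
     (real j + 2) * (real j + 1) * coeff f (j + 2) + (b - a) * (real j + 1) * coeff f (j + 1)
     - real j * (real j + a + b + 1) * coeff f j"
proof -
  consider "j = 0" | "j = 1" | i where "j = Suc (Suc i)"
    by (metis One_nat_def not0_implies_Suc)
  then show ?thesis
    by cases (simp_all add: jacobi_operator_def coeff_pderiv algebra_simps numeral_2_eq_2)
qed

text \<open>With \<open>u = f g' - g f'\<close> one has \<open>u' = f g'' - g f''\<close>, so the difference of the two integrands is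
  the total derivative treated above.\<close>

lemma jacobi_operator_symmetric:
  assumes "a > -1" "b > -1"
  shows "jacobi_functional a b (f * jacobi_operator a b g) = jacobi_functional a b (g * jacobi_operator a b f)"
proof -
  define u where "u = f * pderiv g - g * pderiv f"
  have "pderiv u = f * pderiv (pderiv g) - g * pderiv (pderiv f)"
    by (simp add: u_def pderiv_diff pderiv_mult algebra_simps)
  then have "f * jacobi_operator a b g - g * jacobi_operator a b f =
      [:1, 0, -1:] * pderiv u + [:b - a, - (a + b + 2):] * u"
    unfolding jacobi_operator_def u_def by algebra
  then have "jacobi_functional a b (f * jacobi_operator a b g - g * jacobi_operator a b f) = 0"
    by (simp only: jacobi_functional_total_derivative[OF assms])
  then show ?thesis
    by (simp add: jacobi_functional_diff[OF assms])
qed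

text \<open>By symmetry the operator maps \<open>f = P (m + 1)\<close> to a polynomial that is still orthogonal to
  \<open>v = P m\<close>.  Adding the multiple of \<open>f\<close> that cancels the power \<open>x ^ (m + 1)\<close> leaves a polynomial
  of degree at most \<open>m\<close> orthogonal to \<open>P m\<close>, so its coefficient of \<open>x ^ m\<close> vanishes as well.  That
  coefficient involves only the two leading coefficients of \<open>f\<close>.\<close>

lemma jacobi_polynomials_subleading_coeff:
  assumes P: "jacobi_polynomials a b P" and ab: "a > -1" "b > -1"
  shows "(2 * (real m + 1) + a + b) * coeff (P (m + 1)) m = (real m + 1) * (a - b) * coeff (P (m + 1)) (m + 1)"
proof -
  define f where "f = P (m + 1)"
  define v where "v = P m"
  define r where "r = jacobi_operator a b f + smult ((real m + 1) * (real m + a + b + 2)) f"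
  have deg: "degree f = m + 1" "degree v = m"
    using P by (simp_all add: f_def v_def)
  have "degree (jacobi_operator a b v) \<le> m"
    by (intro degree_le) (auto simp: coeff_jacobi_operator deg coeff_eq_0)
  then have "jacobi_functional a b (v * jacobi_operator a b f) = 0"
    using jacobi_operator_symmetric[OF ab, of v f] jacobi_orthogonal_lower_degree[OF P ab, of _ "m + 1"]
    by (simp add: f_def)
  moreover have "jacobi_functional a b (v * f) = 0"
    unfolding v_def f_def by (rule jacobi_polynomials_orthogonal[OF P]) simp
  moreover have "v * r = v * jacobi_operator a b f + smult ((real m + 1) * (real m + a + b + 2)) (v * f)"
    by (simp add: r_def algebra_simps)
  ultimately have "jacobi_functional a b (v * r) = 0"
    by (simp add: jacobi_functional_add[OF ab] jacobi_functional_smult)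
  moreover have "degree r \<le> m"
  proof (intro degree_le allI impI)
    fix i assume "m < i"
    then consider "i = m + 1" | "i > m + 1" by linarith
    then show "coeff r i = 0"
      by cases (auto simp: r_def coeff_jacobi_operator deg coeff_eq_0 algebra_simps)
  qed
  ultimately have "coeff r m * jacobi_functional a b (v * v) = 0"
    using jacobi_functional_leading_coeff[OF P ab, of r m] by (simp add: v_def)
  then have "coeff r m = 0"
    using jacobi_functional_square_pos[OF ab, of v] jacobi_polynomials_nonzero[OF P, of m]
    by (auto simp: v_def)
  then show ?thesis
    unfolding f_def[symmetric]
    by (simp add: r_def coeff_jacobi_operator deg coeff_eq_0 algebra_simps)
qed

section \<open>Values at the zeros of the shifted polynomial\<close>

text \<open>The value of \<open>P n\<close> at a zero \<open>v\<close> of \<open>q = Q (n + 1)\<close> is compared with that of the cofactor \<open>g\<close>,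
  which has the same degree \<open>n\<close>.  The combination \<open>g(v) P n - P n (v) g\<close> vanishes at \<open>v\<close>, hence is
  \<open>(x - v) s\<close> with \<open>degree s < n + 1\<close>; multiplied by \<open>g\<close> it becomes \<open>q s\<close>, which the functional for
  \<open>b + 1\<close> annihilates.  So, if \<open>g(v) \<noteq> 0\<close>, \<open>P n (v) / g(v)\<close> is the quotient of the integrals of \<open>P n * g\<close> and \<open>g\<^sup>2\<close>.
  The first of these is the integral of \<open>P n\<close> against \<open>(1 + x) g\<close> for the parameter \<open>b\<close>, that is, the
  component of \<open>(1 + x) g\<close> along \<open>P n\<close>.  It depends linearly on \<open>v\<close> through the two leading
  coefficients of \<open>(1 + x) g\<close>, and \<open>l\<close> is the point where it vanishes.\<close>

lemma jacobi_value_at_zero: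
  assumes P: "jacobi_polynomials a b P" and Q: "jacobi_polynomials a (b + 1) Q"
    and ab: "a > -1" "b > -1"
    and l: "l = -1 + 2 * (real n + 1) * (a + real n + 1)
                     / ((a + b + 2 * real n + 2) * (a + b + 2 * real n + 3))"
    and q: "Q (n + 1) = [:- v, 1:] * g"
  shows "coeff (P n) n * poly (P n) v * jacobi_functional a (b + 1) (g * g) =
     poly g v * coeff (Q (n + 1)) (n + 1) * (v - l) * jacobi_functional a b (P n * P n)"
proof -
  define p where "p = P n"
  define J where "J = jacobi_functional a b"
  define J' where "J' = jacobi_functional a (b + 1)"
  have ab': "b + 1 > -1" using ab by simp
  have g0: "g \<noteq> 0" using q jacobi_polynomials_nonzero[OF Q, of "n + 1"] by auto
  have dq: "degree (Q (n + 1)) = n + 1" using Q by simp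
  then have dg: "degree g = n"
    using g0 unfolding q by (subst (asm) degree_mult_eq) auto
  have dp: "degree p = n" using P by (simp add: p_def)

  define h where "h = smult (poly g v) p - smult (poly p v) g"
  have "poly h v = 0" by (simp add: h_def)
  then obtain s where s: "h = [:- v, 1:] * s"
    by (metis dvdE poly_eq_0_iff_dvd)
  have "degree h \<le> n" using dp dg by (auto simp: h_def intro!: degree_diff_le)
  then have "degree s < n + 1"
    by (cases "s = 0") (simp_all add: s degree_mult_eq del: mult_pCons_left)
  then have "J' (Q (n + 1) * s) = 0"
    unfolding J'_def by (rule jacobi_orthogonal_lower_degree[OF Q ab(1) ab'])
  moreover have "Q (n + 1) * s = smult (poly g v) (p * g) - smult (poly p v) (g * g)"
  proof -
    have "Q (n + 1) * s = h * g" unfolding q s by (simp only: mult_ac)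
    then show ?thesis by (simp add: h_def algebra_simps)
  qed
  ultimately have eq1: "poly p v * J' (g * g) = poly g v * J' (p * g)"
    by (simp add: J'_def jacobi_functional_diff[OF ab(1) ab'] jacobi_functional_smult)

  define K where "K = P (n + 1)"
  define k where "k = coeff K (n + 1)"
  define c where "c = coeff (Q (n + 1)) (n + 1)"
  have k0: "k \<noteq> 0"
    unfolding k_def K_def by (rule jacobi_polynomials_coeff_nonzero[OF P])
  have gn: "coeff g n = c"
    unfolding c_def q using dg by (simp add: coeff_eq_0)
  \<comment> \<open>Subtracting the \<open>P (n + 1)\<close> component changes no integral against \<open>P n\<close> and brings the degree down to \<open>n\<close>.\<close>
  define r where "r = [:1, 1:] * g - smult (c / k) K"
  have r_lin: "p * r = [:1, 1:] * (p * g) - smult (c / k) (p * K)"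
    by (simp add: r_def algebra_simps)
  have "J (p * K) = 0"
    unfolding J_def p_def K_def by (rule jacobi_polynomials_orthogonal[OF P]) simp
  then have "J (p * r) = J' (p * g)"
    unfolding r_lin J_def J'_def
    by (simp add: jacobi_functional_diff[OF ab] jacobi_functional_smult jacobi_functional_Suc_weight)
  moreover have "degree r \<le> n"
  proof (intro degree_le allI impI)
    fix i assume "n < i"
    then consider "i = n + 1" | "i > n + 1" by linarith
    then show "coeff r i = 0"
    proof cases
      case 1
      then show ?thesis using k0 dg by (simp add: r_def gn k_def coeff_eq_0)
    next
      case 2
      then obtain j where "i = Suc j" "j > n" by (cases i) auto
      then show ?thesis using dg P by (simp add: r_def K_def coeff_eq_0)
    qed
  qed
  ultimately have eq2: "coeff p n * J' (p * g) = coeff r n * J (p * p)"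
    using jacobi_functional_leading_coeff[OF P ab, of r n] by (simp add: p_def J_def)

  have "coeff r n = c * (v - l)"
  proof -
    define A where "A = 2 * (real n + 1) + a + b"
    have A: "A > 0" using ab by (simp add: A_def)
    have "coeff ([:1, 1:] * g) n = c * (1 + v) + coeff (Q (n + 1)) n"
      unfolding q using gn by (cases n) (auto simp: algebra_simps)
    moreover have "A * coeff K n = (real n + 1) * (a - b) * k"
      using jacobi_polynomials_subleading_coeff[OF P ab, of n] by (simp add: K_def k_def A_def)
    then have "coeff K n = (real n + 1) * (a - b) * k / A"
      using A by (simp add: field_simps)
    moreover have "(A + 1) * coeff (Q (n + 1)) n = (real n + 1) * (a - b - 1) * c"
      using jacobi_polynomials_subleading_coeff[OF Q ab(1) ab', of n]
      by (simp add: c_def A_def algebra_simps)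
    then have "coeff (Q (n + 1)) n = (real n + 1) * (a - b - 1) * c / (A + 1)"
      using A by (simp add: field_simps)
    moreover have "l = -1 + 2 * (real n + 1) * (a + real n + 1) / (A * (A + 1))"
      unfolding l A_def by (simp add: algebra_simps)
    \<comment> \<open>Up to the factor \<open>c\<close>, \<open>X\<close> and \<open>Y\<close> are the subleading coefficients of \<open>Q (n + 1)\<close> and of the multiple of \<open>P (n + 1)\<close>.\<close>
    moreover define X Y Z where "X = (real n + 1) * (a - b - 1) / (A + 1)"
      and "Y = (real n + 1) * (a - b) / A"
      and "Z = 2 * (real n + 1) * (a + real n + 1) / (A * (A + 1))"
    ultimately have r_l: "coeff r n = c * (1 + v) + X * c - c * Y" "l = -1 + Z"
      using k0 by (simp_all add: r_def)
    have "X - Y = (real n + 1) * ((a - b - 1) * A - (a - b) * (A + 1)) / (A * (A + 1))"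
      unfolding X_def Y_def using A by (simp add: divide_simps) (simp add: algebra_simps)
    also have "(a - b - 1) * A - (a - b) * (A + 1) = - (2 * (a + real n + 1))"
      by (simp add: A_def algebra_simps)
    finally have "X - Y = - Z"
      unfolding Z_def by (simp only: mult_minus_right minus_divide_left mult_ac)
    with r_l show ?thesis by algebra
  qed
  with eq1 eq2 show ?thesis
    unfolding p_def[symmetric] J_def[symmetric] J'_def[symmetric] c_def[symmetric] by algebra
qed

section \<open>Sign changes and counting of zeros\<close>

lemma factor_out_roots:
  fixes p :: "real poly"
  assumes "finite S" "p \<noteq> 0" "\<And>x. x \<in> S \<Longrightarrow> poly p x = 0"
  obtains r where "p = (\<Prod>x\<in>S. [:- x, 1:]) * r" "degree r + card S = degree p"
proof -
  have "\<exists>r. p = (\<Prod>x\<in>S. [:- x, 1:]) * r \<and> degree r + card S = degree p"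
    using assms(1,3)
  proof (induction S rule: finite_induct)
    case (insert a S)
    then obtain r where r: "p = (\<Prod>x\<in>S. [:- x, 1:]) * r" "degree r + card S = degree p"
      by auto
    have "poly (\<Prod>x\<in>S. [:- x, 1:]) a \<noteq> 0"
      using insert.hyps by (auto simp: poly_prod)
    then have "poly r a = 0"
      using insert.prems[of a] r(1) by simp
    then obtain r' where r': "r = [:- a, 1:] * r'"
      by (metis dvdE poly_eq_0_iff_dvd)
    with r(1) \<open>p \<noteq> 0\<close> have "r' \<noteq> 0" by auto
    then have "degree r = Suc (degree r')"
      by (simp add: r' degree_mult_eq del: mult_pCons_left)
    moreover have "p = (\<Prod>x\<in>insert a S. [:- x, 1:]) * r'"
      unfolding r(1) r' using insert.hyps by (simp only: prod.insert mult_ac not_False_eq_True)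
    ultimately show ?case
      using r(2) insert.hyps by (intro exI[of _ r']) simp
  qed auto
  then show ?thesis using that by blast
qed

lemma factor_over_roots:
  fixes p :: "real poly"
  assumes "finite S" "p \<noteq> 0" "\<And>x. x \<in> S \<Longrightarrow> poly p x = 0" "card S = degree p"
  shows "p = smult (lead_coeff p) (\<Prod>x\<in>S. [:- x, 1:])"
proof -
  obtain r where r: "p = (\<Prod>x\<in>S. [:- x, 1:]) * r" "degree r + card S = degree p"
    using factor_out_roots[OF assms(1-3)] by metis
  then obtain c where "r = [:c:]"
    using assms(4) by (metis add_0 add_right_cancel degree_eq_zeroE)
  with r(1) have c: "p = smult c (\<Prod>x\<in>S. [:- x, 1:])" by simp
  moreover have "lead_coeff (smult c (\<Prod>x\<in>S. [:- x, 1:])) = c"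
    by (simp add: lead_coeff_smult lead_coeff_prod)
  ultimately show ?thesis by metis
qed

lemma order_eq_1_if_all_roots_distinct:
  fixes p :: "real poly"
  assumes "p \<noteq> 0" "card {x. poly p x = 0} = degree p" "poly p a = 0"
  shows "order a p = 1"
proof -
  define S where "S = {x. poly p x = 0}"
  define g where "g = smult (lead_coeff p) (\<Prod>x\<in>S - {a}. [:- x, 1:])"
  have S: "finite S" "a \<in> S"
    using poly_roots_finite[OF assms(1)] assms(3) by (simp_all add: S_def)
  have "p = smult (lead_coeff p) (\<Prod>x\<in>S. [:- x, 1:])"
    using assms S by (intro factor_over_roots) (auto simp: S_def)
  then have p: "p = [:- a, 1:] * g"
    using S by (simp add: g_def prod.remove del: mult_pCons_left)
  have "poly g a \<noteq> 0"
    using S assms(1) by (auto simp: g_def poly_prod)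
  moreover have "order a p = order a [:- a, 1:] + order a g"
    using order_mult[of "[:- a, 1:]" g a] p \<open>p \<noteq> 0\<close> by metis
  ultimately show ?thesis
    using order_power_n_n[of a 1] by (simp add: order_0I)
qed

lemma prod_neg_sign:
  fixes f :: "'a \<Rightarrow> real"
  assumes "\<And>x. x \<in> S \<Longrightarrow> f x < 0"
  shows "(-1) ^ card S * prod f S > 0"
proof -
  have "(-1) ^ card S * prod f S = (\<Prod>x\<in>S. - f x)"
    by (simp add: prod_uminus)
  also have "\<dots> > 0" using assms by (intro prod_pos) auto
  finally show ?thesis .
qed

text \<open>The product is the derivative of \<open>\<Prod>j. x - w j\<close> at its zero \<open>w i\<close>, and exactly \<open>m - i\<close> of its factors
  are negative.\<close>

lemma prod_differences_sign:
  fixes w :: "nat \<Rightarrow> real"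
  assumes "strict_mono_on {1..m} w" "i \<in> {1..m}"
  shows "(-1) ^ (m - i) * (\<Prod>j\<in>{1..m} - {i}. w i - w j) > 0"
proof -
  have split: "{1..m} - {i} = {1..<i} \<union> {i<..m}" using assms(2) by auto
  have "(\<Prod>j\<in>{1..m} - {i}. w i - w j) = (\<Prod>j\<in>{1..<i}. w i - w j) * (\<Prod>j\<in>{i<..m}. w i - w j)"
    unfolding split by (rule prod.union_disjoint) auto
  moreover have "(\<Prod>j\<in>{1..<i}. w i - w j) > 0"
    using assms by (intro prod_pos) (auto simp: strict_mono_on_def)
  moreover have "(-1) ^ (m - i) * (\<Prod>j\<in>{i<..m}. w i - w j) > 0"
    using prod_neg_sign[of "{i<..m}" "\<lambda>j. w i - w j"] assms by (auto simp: strict_mono_on_def)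
  ultimately show ?thesis by (metis mult.left_commute mult_pos_pos)
qed

lemma gaps_disjoint:
  fixes v :: "nat \<Rightarrow> real"
  assumes "strict_mono_on {..n + 1} v" "x \<in> {v i<..<v (i + 1)}" "x \<in> {v j<..<v (j + 1)}" "i \<le> n" "j \<le> n"
  shows "i = j"
  using assms strict_mono_on_leD[OF assms(1), of "i + 1" j] strict_mono_on_leD[OF assms(1), of "j + 1" i]
  by (cases i j rule: linorder_cases) auto

text \<open>The sign condition says that \<open>p\<close> changes sign across each gap between consecutive points
  \<open>v 1, ..., v (n + 1)\<close>, except across one that contains \<open>l\<close>.  This yields zeros in all gaps but one,
  and the degree \<open>n\<close> decides the rest.  If \<open>l\<close> were beyond the last point, all \<open>n\<close> zeros would be to
  the left of \<open>v (n + 1)\<close>, and the sign of \<open>p\<close> there would be that of its leading coefficient, against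
  the sign condition.
  If \<open>l\<close> lies in the first gap, the \<open>n\<close> zeros found are all there are.  Otherwise one zero is still
  missing; it is real, since the quotient of \<open>p\<close> by the factors found is linear, and the sign at \<open>v 1\<close>
  puts it to the left of \<open>v 1\<close>, hence in the first gap.\<close>

lemma zeros_and_extra_point_in_gaps:
  fixes p :: "real poly" and v :: "nat \<Rightarrow> real" and l :: real
  assumes mono: "strict_mono_on {..n + 1} v"
    and deg: "degree p = n" and "p \<noteq> 0"
    and sign: "\<And>i. i \<in> {1..n + 1} \<Longrightarrow>
      (-1) ^ (n + 1 - i) * (lead_coeff p * poly p (v i)) * (v i - l) > 0"
    and roots: "\<And>t. poly p t = 0 \<Longrightarrow> v 0 < t" and l: "v 0 < l"
  obtains k z where "k \<le> n" "l \<in> {v k<..<v (k + 1)}"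
    "\<And>i. i \<le> n \<Longrightarrow> i \<noteq> k \<Longrightarrow> z i \<in> {v i<..<v (i + 1)}"
    "{t. poly p t = 0} = z ` ({..n} - {k})" "inj_on z ({..n} - {k})"
proof -
  define c where "c = lead_coeff p"
  have c: "c \<noteq> 0" using \<open>p \<noteq> 0\<close> by (simp add: c_def)
  have v_less: "v i < v j" if "i < j" "j \<le> n + 1" for i j
    using mono that by (auto simp: strict_mono_on_def)
  have v_le: "v i \<le> v j" if "i \<le> j" "j \<le> n + 1" for i j
    using v_less[of i j] that by (cases "i = j") auto
  note same_gap = gaps_disjoint[OF mono]
  have l_neq: "l \<noteq> v i" if "i \<in> {1..n + 1}" for i
    using sign[OF that] by auto

  \<comment> \<open>\<open>l\<close> is on the same side of both ends of such a gap, so the alternating sign forces a sign change of \<open>p\<close>.\<close>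
  have "\<exists>t. t \<in> {v i<..<v (i + 1)} \<and> poly p t = 0" if i: "i \<in> {1..n}" and "l \<notin> {v i<..<v (i + 1)}" for i
  proof -
    have "v i < v (i + 1)" "l \<noteq> v i" "l \<noteq> v (i + 1)"
      using v_less[of i "i + 1"] l_neq[of i] l_neq[of "i + 1"] i by auto
    then have same_side: "(v i - l) * (v (i + 1) - l) > 0"
      using that(2) by (auto simp: zero_less_mult_iff)
    define e :: real where "e = (-1) ^ (n - i)"
    have "n + 1 - i = Suc (n - i)" using i by auto
    then have "- e * (c * poly p (v i)) * (v i - l) > 0" "e * (c * poly p (v (i + 1))) * (v (i + 1) - l) > 0"
      using sign[of i] sign[of "i + 1"] i by (auto simp: e_def c_def)
    then have "(- e * (c * poly p (v i)) * (v i - l)) * (e * (c * poly p (v (i + 1))) * (v (i + 1) - l)) > 0"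
      by (rule mult_pos_pos)
    moreover have "e * e = 1" by (simp add: e_def flip: power_mult_distrib)
    then have "(- e * (c * poly p (v i)) * (v i - l)) * (e * (c * poly p (v (i + 1))) * (v (i + 1) - l))
        = - (c * c * ((v i - l) * (v (i + 1) - l)) * (poly p (v i) * poly p (v (i + 1))))"
      by algebra
    moreover have "c * c * ((v i - l) * (v (i + 1) - l)) > 0"
      using c same_side by (auto simp: zero_less_mult_iff)
    ultimately have "poly p (v i) * poly p (v (i + 1)) < 0"
      by (metis neg_0_less_iff_less zero_less_mult_pos mult_minus_right)
    then show ?thesis
      using poly_IVT[OF \<open>v i < v (i + 1)\<close>] by auto
  qed
  then obtain z where z: "\<And>i. i \<in> {1..n} \<Longrightarrow> l \<notin> {v i<..<v (i + 1)} \<Longrightarrow>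
      z i \<in> {v i<..<v (i + 1)} \<and> poly p (z i) = 0"
    by metis

  \<comment> \<open>The last point below \<open>l\<close>; \<open>k = n + 1\<close> is excluded further down.\<close>
  define k where "k = Max {i \<in> {..n + 1}. v i < l}"
  have "k \<in> {i \<in> {..n + 1}. v i < l}" unfolding k_def
    by (rule Max_in) (use l in auto)
  then have k: "k \<le> n + 1" "v k < l" by auto
  have k_max: "i \<le> k" if "i \<le> n + 1" "v i < l" for i
    unfolding k_def by (rule Max_ge) (use that in auto)
  define K where "K = {1..n} - {k}"
  have l_gap: "l \<in> {v k<..<v (k + 1)}" if "k \<le> n"
    using k k_max[of "k + 1"] l_neq[of "k + 1"] that by force
  have zK: "z i \<in> {v i<..<v (i + 1)}" "poly p (z i) = 0" if "i \<in> K" for i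
  proof -
    have "l \<notin> {v i<..<v (i + 1)}"
    proof
      assume "l \<in> {v i<..<v (i + 1)}"
      then have "i \<le> k" "v k < v (i + 1)" using k_max[of i] k that by (auto simp: K_def)
      then have "\<not> i + 1 \<le> k" using v_le[of "i + 1" k] k by auto
      then show False using \<open>i \<le> k\<close> that by (simp add: K_def)
    qed
    then show "z i \<in> {v i<..<v (i + 1)}" "poly p (z i) = 0"
      using z[of i] that by (auto simp: K_def)
  qed
  have inj: "inj_on z K"
    by (rule inj_onI) (metis zK(1) same_gap K_def Diff_iff atLeastAtMost_iff)
  have "finite (z ` K)" "\<And>x. x \<in> z ` K \<Longrightarrow> poly p x = 0"
    using zK(2) by (simp add: K_def, blast)
  then obtain r where r: "p = (\<Prod>x\<in>z ` K. [:- x, 1:]) * r" "degree r + card (z ` K) = degree p"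
    using factor_out_roots[of "z ` K" p] \<open>p \<noteq> 0\<close> by metis
  define W where "W x = (\<Prod>i\<in>K. x - z i)" for x
  have p_eq: "poly p x = W x * poly r x" for x
    by (simp add: r(1) poly_prod prod.reindex[OF inj] W_def)
  have deg_r: "degree r + card K = n"
    using r(2) deg card_image[OF inj] by simp
  have lead_r: "coeff r (degree r) = c"
    by (simp add: c_def r(1) lead_coeff_mult lead_coeff_prod)

  have "k \<le> n"
  proof (rule ccontr)
    assume "\<not> k \<le> n"
    then have "k = n + 1" using k by simp
    then have "K = {1..n}" by (auto simp: K_def)
    then have "degree r = 0" using deg_r by simp
    then have "r = [:c:]" using lead_r by (metis degree_eq_zeroE coeff_pCons_0)
    then have "poly p (v (n + 1)) = c * W (v (n + 1))"
      by (simp add: p_eq)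
    moreover have "W (v (n + 1)) > 0" unfolding W_def
    proof (intro prod_pos ballI)
      fix i assume "i \<in> K"
      then show "v (n + 1) - z i > 0"
        using zK(1)[of i] v_le[of "i + 1" "n + 1"] by (auto simp: K_def)
    qed
    moreover have "c * c > 0" using c not_real_square_gt_zero by blast
    ultimately have "c * poly p (v (n + 1)) > 0"
      by (simp only: mult.assoc[symmetric] mult_pos_pos)
    then have "c * poly p (v (n + 1)) * (v (n + 1) - l) < 0"
      using \<open>k = n + 1\<close> k by (intro mult_pos_neg) auto
    moreover have "c * poly p (v (n + 1)) * (v (n + 1) - l) > 0"
      using sign[of "n + 1"] by (simp add: c_def)
    ultimately show False by linarith
  qed

  show ?thesis
  proof (cases "k = 0")
    case True
    then have K: "K = {..n} - {k}" "card K = n" by (auto simp: K_def)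
    have "{t. poly p t = 0} = z ` K"
    proof (rule card_seteq[symmetric])
      show "finite {t. poly p t = 0}" by (rule poly_roots_finite) fact
      show "card {t. poly p t = 0} \<le> card (z ` K)"
        using card_image[OF inj] K(2) card_poly_roots_bound[OF \<open>p \<noteq> 0\<close>] deg by simp
    qed (use zK in auto)
    with that[of k z] \<open>k \<le> n\<close> l_gap zK(1) K inj show ?thesis by auto
  next
    case False
    with \<open>k \<le> n\<close> have "card K = n - 1" "n > 0" by (auto simp: K_def)
    with deg_r have "degree r = 1" by simp
    then obtain r0 where r0: "r = [:r0, c:]"
      using lead_r by (metis degree1_coeffs One_nat_def coeff_pCons_0 coeff_pCons_Suc)
    define t where "t = - r0 / c"
    have r_eq: "poly r x = c * (x - t)" for x
      using c by (simp add: r0 t_def field_simps)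
    have "poly p t = 0" by (simp add: p_eq r_eq)
    then have "v 0 < t" by (rule roots)
    define e :: real where "e = (-1) ^ card K"
    have "e * W (v 1) > 0" unfolding W_def e_def
    proof (rule prod_neg_sign)
      fix i assume "i \<in> K"
      then show "v 1 - z i < 0"
        using zK(1)[of i] v_le[of 1 i] by (auto simp: K_def)
    qed
    moreover have "v 1 < l" using v_le[of 1 k] k False by simp
    moreover have e_eq: "(-1) ^ n = - e" unfolding e_def
      using \<open>card K = n - 1\<close> \<open>n > 0\<close> by (cases n) auto
    moreover have "c * c > 0" using c not_real_square_gt_zero by blast
    ultimately have "c * c * (e * W (v 1)) * (l - v 1) > 0" by simp
    moreover have "(-1) ^ n * (c * poly p (v 1)) * (v 1 - l) =
        c * c * (e * W (v 1)) * (l - v 1) * (v 1 - t)"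
      by (simp only: p_eq r_eq e_eq) (simp add: algebra_simps)
    then have "c * c * (e * W (v 1)) * (l - v 1) * (v 1 - t) > 0"
      using sign[of 1] unfolding c_def by (metis add_diff_cancel_right' atLeastAtMost_iff le_add2 le_refl)
    ultimately have "v 1 - t > 0" by (metis zero_less_mult_pos)
    \<comment> \<open>\<open>z 0\<close> was unspecified so far; it is now set to the zero of the linear factor.\<close>
    define y where "y = z(0 := t)"
    have y: "y i \<in> {v i<..<v (i + 1)}" "poly p (y i) = 0" if "i \<in> {..n} - {k}" for i
      using zK[of i] that \<open>v 0 < t\<close> \<open>v 1 - t > 0\<close> \<open>poly p t = 0\<close> by (auto simp: y_def K_def)
    have inj_y: "inj_on y ({..n} - {k})"
      by (rule inj_onI) (metis y(1) same_gap Diff_iff atMost_iff)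
    have "{t. poly p t = 0} = y ` ({..n} - {k})"
    proof (rule card_seteq[symmetric])
      show "finite {t. poly p t = 0}" by (rule poly_roots_finite) fact
      show "card {t. poly p t = 0} \<le> card (y ` ({..n} - {k}))"
        using card_image[OF inj_y] card_poly_roots_bound[OF \<open>p \<noteq> 0\<close>] deg \<open>k \<le> n\<close> by simp
    qed (use y in auto)
    with that[of k y] \<open>k \<le> n\<close> l_gap y(1) inj_y show ?thesis by auto
  qed
qed

section \<open>Interlacing of Jacobi polynomials with shifted parameters\<close>

theorem theorem1:
  fixes n :: nat and \<alpha> \<beta> l :: real
    and P Q :: "nat \<Rightarrow> real poly"
    and w :: "nat \<Rightarrow> real"
  assumes n: "n \<ge> 1"
    and \<alpha>: "\<alpha> > -1"
    and \<beta>: "\<beta> > 0"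
    and P: "jacobi_polynomials \<alpha> \<beta> P"
    and Q: "jacobi_polynomials \<alpha> (\<beta> + 1) Q"
    and no_common: "\<not> (\<exists>x. poly (P n) x = 0 \<and> poly (Q (n + 1)) x = 0)"
    and l: "l = -1 + 2 * (real n + 1) * (\<alpha> + real n + 1)
                     / ((\<alpha> + \<beta> + 2 * real n + 2) * (\<alpha> + \<beta> + 2 * real n + 3))"
    and w_order: "-1 < w 1" "strict_mono_on {1..n+1} w" "w (n + 1) < 1"
    and w_zeros: "w ` {1..n+1} = {x. poly (Q (n + 1)) x = 0}"
  shows "(\<forall>i\<le>n. let I = {(if i = 0 then -1 else w i)<..<w (i + 1)} in
            ((\<exists>x. {t \<in> I. poly (P n) t = 0} = {x} \<and> order x (P n) = 1) \<and> l \<notin> I) \<or>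
            ({t \<in> I. poly (P n) t = 0} = {} \<and> l \<in> I))
       \<and> (interlacing_zeros (P n) (Q (n + 1)) \<longleftrightarrow> w 1 > l)"
proof -
  define p where "p = P n"
  define q where "q = Q (n + 1)"
  have ab: "\<alpha> > -1" "\<beta> > -1" "\<beta> + 1 > -1" using \<alpha> \<beta> by auto
  have p0: "p \<noteq> 0" and dp: "degree p = n"
    using jacobi_polynomials_nonzero[OF P] P by (simp_all add: p_def)
  have q0: "q \<noteq> 0" and dq: "degree q = n + 1"
    using jacobi_polynomials_nonzero[OF Q] Q by (simp_all add: q_def)
  have inj_w: "inj_on w {1..n + 1}"
    using w_order(2) by (rule strict_mono_on_imp_inj_on)
  have card_q: "card {x. poly q x = 0} = degree q"
    using card_image[OF inj_w] unfolding w_zeros q_def[symmetric] dq by simp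
  have q_zero: "poly q x = 0 \<longleftrightarrow> (\<exists>j\<in>{1..n + 1}. x = w j)" for x
  proof -
    have "poly q x = 0 \<longleftrightarrow> x \<in> w ` {1..n + 1}" unfolding w_zeros q_def by simp
    then show ?thesis by blast
  qed
  have "q = smult (lead_coeff q) (\<Prod>x\<in>w ` {1..n + 1}. [:- x, 1:])"
    unfolding w_zeros q_def[symmetric]
    using q0 card_q by (intro factor_over_roots) (simp_all add: poly_roots_finite)
  then have q_eq: "q = smult (lead_coeff q) (\<Prod>j\<in>{1..n + 1}. [:- w j, 1:])"
    by (simp only: prod.reindex[OF inj_w] o_def)

  \<comment> \<open>The cofactor of \<open>x - w i\<close> in \<open>q\<close> has alternating signs at the \<open>w i\<close>, so those of \<open>p\<close> alternate up to the sign of \<open>w i - l\<close>.\<close>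
  have sign: "(-1) ^ (n + 1 - i) * (lead_coeff p * poly p (w i)) * (w i - l) > 0"
    if i: "i \<in> {1..n + 1}" for i
  proof -
    define g where "g = smult (lead_coeff q) (\<Prod>j\<in>{1..n + 1} - {i}. [:- w j, 1:])"
    have q_factor: "q = [:- w i, 1:] * g"
      by (subst q_eq) (simp only: g_def prod.remove[OF _ i] finite_atLeastAtMost mult_smult_right)
    define e :: real where "e = (-1) ^ (n + 1 - i)"
    define E where "E = e * (\<Prod>j\<in>{1..n + 1} - {i}. w i - w j)"
    define G where "G = jacobi_functional \<alpha> (\<beta> + 1) (g * g)"
    define H where "H = jacobi_functional \<alpha> \<beta> (p * p)"
    have "E > 0" unfolding E_def e_def by (rule prod_differences_sign[OF w_order(2) i])
    have "g \<noteq> 0" using q_factor q0 by auto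
    then have "G > 0" unfolding G_def by (rule jacobi_functional_square_pos[OF ab(1,3)])
    have "H > 0" unfolding H_def by (rule jacobi_functional_square_pos[OF ab(1,2) p0])
    have "e * poly g (w i) = lead_coeff q * E"
      by (simp add: g_def E_def poly_prod mult_ac)
    moreover have "lead_coeff p * poly p (w i) * G = poly g (w i) * lead_coeff q * (w i - l) * H"
      using jacobi_value_at_zero[OF P Q ab(1,2) l q_factor[unfolded q_def]]
      unfolding p_def q_def G_def H_def using P Q by simp
    ultimately have "e * (lead_coeff p * poly p (w i)) * G =
        lead_coeff q * lead_coeff q * E * H * (w i - l)"
      by algebra
    then have "G * (e * (lead_coeff p * poly p (w i)) * (w i - l)) =
        (lead_coeff q * lead_coeff q) * E * H * ((w i - l) * (w i - l))" (is "G * ?s = ?t")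
      by algebra
    moreover have "poly q (w i) = 0" using i unfolding q_zero by blast
    then have "poly p (w i) \<noteq> 0" using no_common by (auto simp: p_def q_def)
    \<comment> \<open>Here the absence of common zeros enters: it keeps \<open>l\<close> away from the zeros of \<open>q\<close>.\<close>
    then have "w i \<noteq> l"
      using \<open>lead_coeff p * poly p (w i) * G = _\<close> \<open>G > 0\<close> p0 by auto
    then have "(w i - l) * (w i - l) > 0" "lead_coeff q * lead_coeff q > 0"
      using q0 not_real_square_gt_zero by (metis right_minus_eq, metis leading_coeff_0_iff)
    then have "?t > 0" using \<open>E > 0\<close> \<open>H > 0\<close> by (simp only: mult_pos_pos)
    ultimately have "G * ?s > 0" by (simp only:)
    then show ?thesis unfolding e_def using \<open>G > 0\<close> by (rule zero_less_mult_pos)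
  qed

  \<comment> \<open>Prepending the endpoint \<open>-1\<close> makes the \<open>n + 1\<close> intervals uniform: they are the gaps of \<open>v\<close>.\<close>
  define v where "v i = (if i = 0 then -1 else w i)" for i
  have mono_v: "strict_mono_on {..n + 1} v"
  proof (rule strict_mono_onI)
    fix i j assume "i \<in> {..n + 1}" "j \<in> {..n + 1}" "i < j"
    moreover from this have "w 1 \<le> w j"
      using strict_mono_on_leD[OF w_order(2), of 1 j] by auto
    ultimately show "v i < v j"
      using w_order(1) strict_mono_onD[OF w_order(2), of i j] by (cases "i = 0") (auto simp: v_def)
  qed
  have sign_v: "(-1) ^ (n + 1 - i) * (lead_coeff p * poly p (v i)) * (v i - l) > 0"
    if "i \<in> {1..n + 1}" for i
    using sign[OF that] that by (simp add: v_def)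
  have roots: "v 0 < t" if "poly p t = 0" for t
    using jacobi_polynomials_root_gt[OF P ab(1,2)] that by (simp add: p_def v_def)
  have "v 0 < l" unfolding l v_def using \<alpha> \<beta> by simp
  obtain k z where k: "k \<le> n" "l \<in> {v k<..<v (k + 1)}"
    and z: "\<And>i. i \<le> n \<Longrightarrow> i \<noteq> k \<Longrightarrow> z i \<in> {v i<..<v (i + 1)}"
    and zeros: "{t. poly p t = 0} = z ` ({..n} - {k})" and inj_z: "inj_on z ({..n} - {k})"
    by (rule zeros_and_extra_point_in_gaps[OF mono_v dp p0 sign_v roots \<open>v 0 < l\<close>]; (assumption | (rule that; assumption)))
  have card_p: "card {x. poly p x = 0} = degree p"
    using k by (simp add: zeros card_image[OF inj_z] dp)
  note same_gap = gaps_disjoint[OF mono_v]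
  have zero_in_gap: "\<exists>i\<le>n. i \<noteq> k \<and> t = z i" if "poly p t = 0" for t
  proof -
    have "t \<in> z ` ({..n} - {k})" using that zeros by blast
    then show ?thesis by blast
  qed
  have gap_k: "{t \<in> {v k<..<v (k + 1)}. poly p t = 0} = {}"
    using zero_in_gap z same_gap k(1) by blast
  have gap: "{t \<in> {v i<..<v (i + 1)}. poly p t = 0} = {z i}" if "i \<le> n" "i \<noteq> k" for i
  proof (intro equalityI subsetI)
    fix t assume t: "t \<in> {t \<in> {v i<..<v (i + 1)}. poly p t = 0}"
    then obtain j where j: "j \<le> n" "j \<noteq> k" "t = z j" using zero_in_gap by blast
    then have "t \<in> {v j<..<v (j + 1)}" using z by blast
    then have "j = i" using t same_gap j(1) that(1) by blast
    then show "t \<in> {z i}" using j by simp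
  next
    fix t assume "t \<in> {z i}"
    then show "t \<in> {t \<in> {v i<..<v (i + 1)}. poly p t = 0}" using zeros z[OF that] that by blast
  qed

  have k0: "k = 0 \<longleftrightarrow> l < w 1"
    using k strict_mono_on_leD[OF mono_v, of 1 k] by (cases "k = 0") (auto simp: v_def)

  \<comment> \<open>The exceptional gap \<open>k\<close> lies between two zeros of \<open>q\<close>, and spoils interlacing, unless it is the first one.\<close>
  have "interlacing_zeros p q \<longleftrightarrow> k = 0"
  proof
    assume inter: "interlacing_zeros p q"
    show "k = 0"
    proof (rule ccontr)
      assume "k \<noteq> 0"
      have "poly q (v k) = 0" "poly q (v (k + 1)) = 0"
        using k(1) \<open>k \<noteq> 0\<close> unfolding q_zero v_def by force+
      moreover have "\<forall>x\<in>{v k<..<v (k + 1)}. poly q x \<noteq> 0"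
      proof
        fix x assume x: "x \<in> {v k<..<v (k + 1)}"
        show "poly q x \<noteq> 0"
        proof
          assume "poly q x = 0"
          then obtain j where j: "j \<in> {1..n + 1}" "x = v j"
            unfolding q_zero v_def by force
          have "\<not> j \<le> k" "\<not> k + 1 \<le> j"
            using x j k(1) strict_mono_on_leD[OF mono_v, of j k]
              strict_mono_on_leD[OF mono_v, of "k + 1" j] by auto
          then show False by simp
        qed
      qed
      moreover have "v k < v (k + 1)" using k(2) by simp
      ultimately have "\<exists>!x. x \<in> {v k<..<v (k + 1)} \<and> poly p x = 0"
        using inter unfolding interlacing_zeros_def by blast
      with gap_k show False by blast
    qed
  next
    assume "k = 0"
    show "interlacing_zeros p q"
      unfolding interlacing_zeros_def real_simple_zeros_def
    proof (intro conjI allI impI)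
      fix a b assume *: "a < b \<and> poly q a = 0 \<and> poly q b = 0 \<and> (\<forall>x\<in>{a<..<b}. poly q x \<noteq> 0)"
      then obtain i j where ij: "i \<in> {1..n + 1}" "j \<in> {1..n + 1}" "a = w i" "b = w j"
        unfolding q_zero by blast
      have "i < j"
        using * ij strict_mono_on_leD[OF w_order(2), of j i] by (cases "i < j") auto
      moreover have "\<not> i + 1 < j"
      proof
        assume "i + 1 < j"
        then have "w (i + 1) \<in> {a<..<b}" "i + 1 \<in> {1..n + 1}"
          using ij strict_mono_onD[OF w_order(2)] by auto
        with * show False unfolding q_zero by blast
      qed
      ultimately have "j = i + 1" by simp
      then have "{t \<in> {a<..<b}. poly p t = 0} = {z i}"
        using gap[of i] ij \<open>k = 0\<close> by (simp add: v_def)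
      then have "x \<in> {a<..<b} \<and> poly p x = 0 \<longleftrightarrow> x = z i" for x by blast
      then show "\<exists>!x. x \<in> {a<..<b} \<and> poly p x = 0" by simp
    qed (use p0 q0 dp dq card_p card_q in auto)
  qed
  moreover have "(\<exists>x. {t \<in> {v i<..<v (i + 1)}. poly p t = 0} = {x} \<and> order x p = 1) \<and>
        l \<notin> {v i<..<v (i + 1)} \<or>
      {t \<in> {v i<..<v (i + 1)}. poly p t = 0} = {} \<and> l \<in> {v i<..<v (i + 1)}"
    if "i \<le> n" for i
  proof (cases "i = k")
    case False
    have "poly p (z i) = 0" using gap[OF that False] by blast
    then have "order (z i) p = 1" by (rule order_eq_1_if_all_roots_distinct[OF p0 card_p])
    moreover have "l \<notin> {v i<..<v (i + 1)}" using same_gap[OF _ k(2) that k(1)] False by blast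
    ultimately show ?thesis using gap[OF that False] by blast
  qed (use gap_k k in auto)
  moreover have "v (i + 1) = w (i + 1)" for i by (simp add: v_def)
  ultimately show ?thesis
    unfolding Let_def p_def[symmetric] q_def[symmetric] v_def[symmetric] k0[symmetric] by metis
qed

end
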